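(* Let $k\in\mathbb{N}_0$ and $a\in\mathbb{C}\setminus\{0,-1,-2,\ldots\}$. For $m\in\mathbb{N}_0$, the value at $s=-m$ of the meromorphic continuation of $s\mapsto H_k(1,s,a)$ is $$H_k(1,-m,a)=-\alpha_k\frac{B_{m+3}(a)}{m+3}-(\beta_k-2a\alpha_k)\frac{B_{m+2}(a)}{m+2}-(1-a\beta_k+a^2\alpha_k)\frac{B_{m+1}(a)}{m+1}.$$
   Context: $\mathbb{N}_0=\{0,1,2,\ldots\}$. $\alpha_k=\frac32 4^k$, $\beta_k=\frac32 2^k$, and the $k$-augmented centered triangular numbers are given by $A(r+1,k)=\alpha_k r^2+\beta_k r+1$ for integers $r\ge0$. Complex powers are principal: $(r+a)^{-s}=\exp\{-s\operatorname{Log}(r+a)\}$, $-\pi<\operatorname{Arg}\le\pi$. For $\operatorname{Re}(s)>3$, $H_k(1,s,a)=\sum_{r=0}^{\infty}\frac{A(r+1,k)}{(r+a)^s}$; it is continued meromorphically to $s\in\mathbb{C}$ by $H_k(1,s,a)=\alpha_k\zeta(s-2,a)+(\beta_k-2a\alpha_k)\zeta(s-1,a)+(1-a\beta_k+a^2\alpha_k)\zeta(s,a)$, where $\zeta(s,a)$ is the (meromorphically continued) Hurwitz zeta function. $B_n(a)$ denotes the Bernoulli polynomials. *)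

theory Defs
  imports "HOL-Complex_Analysis.Complex_Analysis"
begin

(* fps_exp 1 - 1 has no constant term, so this is a quotient of power series of
   subdegree at least 1: the generating function x e^(a x) / (e^x - 1). *)
definition bernpoly :: "nat \<Rightarrow> complex \<Rightarrow> complex" where
  "bernpoly n a = fact n * fps_nth (fps_X * fps_exp a / (fps_exp 1 - 1)) n"

definition \<alpha> :: "nat \<Rightarrow> real" where
  "\<alpha> k = 3 / 2 * 4 ^ k"

definition \<beta> :: "nat \<Rightarrow> real" where
  "\<beta> k = 3 / 2 * 2 ^ k"

(* The k-augmented centered triangular numbers, indexed from 1:
   aug_tri (r + 1) k = \<alpha> k * r^2 + \<beta> k * r + 1. *)
definition aug_tri :: "nat \<Rightarrow> nat \<Rightarrow> real" where
  "aug_tri n k = \<alpha> k * (real n - 1)\<^sup>2 + \<beta> k * (real n - 1) + 1"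

(* A function that is nicely meromorphic on the plane is continuous at every point
   that is not a pole, and is 0 at the poles.  There is hence at most one such function
   extending a given f on a nonempty open set U (lemma below), and its value at a
   regular point is the value of the meromorphic continuation there. *)
definition meromorphic_continuation :: "complex set \<Rightarrow> (complex \<Rightarrow> complex) \<Rightarrow> complex \<Rightarrow> complex" where
  "meromorphic_continuation U f =
     (THE F. F nicely_meromorphic_on UNIV \<and> (\<forall>s\<in>U. F s = f s))"

lemma meromorphic_continuation_unique:
  assumes "open U" "U \<noteq> {}"
    and F: "F nicely_meromorphic_on UNIV" "\<forall>s\<in>U. F s = f s"
    and G: "G nicely_meromorphic_on UNIV" "\<forall>s\<in>U. G s = f s"
  shows "F = G"
proof -
  define D where "D = remove_sings (\<lambda>s. F s - G s)"
  have mF: "F meromorphic_on UNIV" and mG: "G meromorphic_on UNIV"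
    using F G by (auto simp: nicely_meromorphic_on_def)
  have mD: "(\<lambda>s. F s - G s) meromorphic_on UNIV"
    using mF mG by (intro meromorphic_intros)
  have D: "D nicely_meromorphic_on UNIV"
    unfolding D_def using mD by (rule remove_sings_nicely_meromorphic)
  have ev_D: "eventually (\<lambda>s. D s = F s - G s) (at w)" for w
    unfolding D_def
    by (rule eventually_remove_sings_eq_at, rule meromorphic_on_isolated_singularity,
        rule meromorphic_on_subset[OF mD], rule subset_UNIV)
  obtain u where u: "u \<in> U" using assms(2) by blast
  have "eventually (\<lambda>s. F s - G s = 0) (at u)"
    using eventually_at_in_open'[OF assms(1) u] by eventually_elim (simp add: F(2) G(2))
  with ev_D[of u] have "eventually (\<lambda>s. D s = 0) (at u)"
    by eventually_elim auto
  hence "frequently (\<lambda>s. D s = 0) (at u)"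
    by (rule eventually_frequently[OF at_neq_bot])
  hence D0: "D w = 0" for w
    by (rule frequently_eq_meromorphic_imp_constant[OF _ D]) auto
  have ev: "eventually (\<lambda>s. F s = G s) (at w)" for w
    using ev_D[of w] by eventually_elim (simp add: D0)
  have "F w = G w" for w
  proof (cases "is_pole F w")
    case True
    moreover have "is_pole G w"
      using True is_pole_cong[OF ev refl] by blast
    ultimately have "\<not> (F \<midarrow>w\<rightarrow> F w)" "\<not> (G \<midarrow>w\<rightarrow> G w)"
      using not_tendsto_and_filterlim_at_infinity[OF at_neq_bot]
      unfolding is_pole_def by blast+
    thus ?thesis
      using F(1) G(1) unfolding nicely_meromorphic_on_def by (metis UNIV_I)
  next
    case False
    moreover have "\<not> is_pole G w"
      using False is_pole_cong[OF ev refl] by blast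
    ultimately have "F \<midarrow>w\<rightarrow> F w" "G \<midarrow>w\<rightarrow> G w"
      using F(1) G(1) unfolding nicely_meromorphic_on_def by blast+
    moreover from this(2) have "F \<midarrow>w\<rightarrow> G w"
      using tendsto_cong[OF ev] by blast
    ultimately show ?thesis using LIM_unique by blast
  qed
  thus ?thesis by auto
qed

lemma meromorphic_continuation_eqI:
  assumes "open U" "U \<noteq> {}"
    and "F nicely_meromorphic_on UNIV" "\<And>s. s \<in> U \<Longrightarrow> F s = f s"
  shows "meromorphic_continuation U f = F"
  unfolding meromorphic_continuation_def
  using assms meromorphic_continuation_unique[OF assms(1,2)] by (intro the_equality) blast+

(* The Dirichlet-type series defining H_k(1, s, a) for Re s > 3.  On complex numbers
   z powr w is exp (w * Ln z) with the principal logarithm. *)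
definition aug_series :: "nat \<Rightarrow> complex \<Rightarrow> complex \<Rightarrow> complex" where
  "aug_series k s a = (\<Sum>r. of_real (aug_tri (r + 1) k) * (of_nat r + a) powr (- s))"

definition aug_hurwitz :: "nat \<Rightarrow> complex \<Rightarrow> complex \<Rightarrow> complex" where
  "aug_hurwitz k s a = meromorphic_continuation {s. Re s > 3} (\<lambda>s. aug_series k s a) s"

end

theory Submission
  imports Defs
begin

text \<open>
  The proof rests on a Bernoulli function \<open>B\<^sub>w(a)\<close> of complex degree \<open>w\<close>, entire in \<open>w\<close>,
  which is the Bernoulli polynomial for \<open>w = n\<close> and satisfies \<open>\<zeta>(1 - w, a) = - B\<^sub>w(a) / w\<close>.
  It is obtained in one stroke, together with its values, by an Euler--Maclaurin type
  regularisation.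

  The truncated sum \<open>D\<^sub>N(w, x) = (\<Sum>j\<le>N. B\<^sub>j * (w gchoose j) * x powr (w - j))\<close> almost solves the
  difference equation \<open>f (x + 1) - f x = w * x powr (w - 1)\<close>: by the recurrence of the
  Bernoulli numbers all terms down to order \<open>w - N - 1\<close> cancel
  (\<open>bernoulli_binomial_cancel\<close>), and the defect is \<open>O(\<bar>x\<bar> powr (Re w - N - 2))\<close>, locally
  uniformly in \<open>w\<close> (\<open>norm_bern_step_le\<close>).  Hence
  \<open>D\<^sub>N(w, R + a) - w * (\<Sum>r<R. (r + a) powr (w - 1))\<close> converges as \<open>R\<close> tends to infinity
  whenever \<open>Re w < N + 1\<close>, and the limit \<open>B\<^sub>w(a)\<close> is holomorphic there.  It is independent
  of \<open>N\<close>, because the additional terms tend to 0 (\<open>bern_partial_tendsto\<close>), so it is entire.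

  Two cases can be read off.  For \<open>Re w < 0\<close> the regularising term tends to 0 and only
  the Hurwitz series remains (\<open>hurwitz_sums_bern_fun\<close>).  For \<open>w = n\<close> and \<open>N = n\<close> the
  difference equation is solved exactly by the Bernoulli polynomial, and the sequence is
  constant (\<open>bern_fun_of_nat\<close>).

  Finally, the augmented triangular numbers are quadratic in \<open>x = r + a\<close>, so the series is a
  combination of three Hurwitz series.  Replacing these by quotients \<open>- B\<^sub>w(a) / w\<close> with
  \<open>w = 3 - s, 2 - s, 1 - s\<close> gives the meromorphic continuation, whose poles lie in
  \<open>{1, 2, 3}\<close>, and the value at \<open>s = - m\<close> follows by substitution.
\<close>

section \<open>The remainder of the binomial series, uniformly in the exponent\<close>

text \<open>
  The factors of the product satisfy \<open>\<bar>v - j\<bar> \<le> M + j\<close>, so the coefficients of \<open>(1 + u)\<^sup>v\<close> are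
  dominated by those of the single series \<open>(1 - u) powr (- M)\<close>.  This is what makes
  the estimates below uniform in the exponent.
\<close>

lemma norm_gbinomial_le:
  fixes v :: complex and M :: real
  assumes "norm v \<le> M"
  shows "norm (v gchoose i) \<le> (- 1) ^ i * ((- M) gchoose i)"
proof -
  have "norm (v gchoose i) = (\<Prod>j<i. norm (v - of_nat j)) / fact i"
    by (simp add: gbinomial_prod_rev norm_divide prod_norm atLeast0LessThan)
  also have "\<dots> \<le> (\<Prod>j<i. M + real j) / fact i"
  proof (intro divide_right_mono prod_mono conjI)
    fix j
    show "norm (v - of_nat j) \<le> M + real j"
      using norm_triangle_ineq4[of v "of_nat j"] assms by simp
  qed auto
  also have "(\<Prod>j<i. M + real j) = (\<Prod>j<i. (- 1) * (- M - real j))"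
    by (intro prod.cong) auto
  also have "\<dots> = (- 1) ^ i * (\<Prod>j<i. - M - real j)"
    by (subst prod.distrib) simp
  finally show ?thesis
    by (simp add: gbinomial_prod_rev atLeast0LessThan)
qed

text \<open>
  For \<open>\<bar>u\<bar> \<le> 1/2\<close> and \<open>i > n\<close>, \<open>\<bar>u\<bar> ^ i\<close> is at most \<open>(2 * \<bar>u\<bar>) ^ Suc n\<close> times \<open>(1/2) ^ i\<close>, so the
  tail is bounded by that factor times the majorant series at \<open>1/2\<close>, whose sum is
  \<open>(1 - 1/2) powr (- M)\<close>.
\<close>

lemma norm_binomial_remainder_le:
  fixes v u :: complex and M :: real
  assumes v: "norm v \<le> M" and u: "norm u \<le> 1 / 2"
  shows "norm ((1 + u) powr v - (\<Sum>i\<le>n. (v gchoose i) * u ^ i))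
           \<le> 2 powr M * (2 * norm u) ^ Suc n"
proof -
  \<comment> \<open>The terms of the majorant series at 1/2; the signs make them nonnegative.\<close>
  define t where "t i = (- 1) ^ i * ((- M) gchoose i) * (1 / 2) ^ i" for i
  have t: "t sums (2 powr M)"
  proof -
    have "(\<lambda>i. ((- M) gchoose i) * (- 1 / 2) ^ i) sums (1 + (- 1 / 2)) powr (- M)"
      by (rule gen_binomial_real) simp
    moreover have "(- 1 / 2 :: real) ^ i = (- 1) ^ i * (1 / 2) ^ i" for i
      by (simp flip: power_mult_distrib)
    moreover have "(1 + (- 1 / 2) :: real) powr (- M) = 2 powr M"
      by (simp add: powr_minus powr_divide)
    ultimately show ?thesis
      unfolding t_def by (simp only: mult_ac)
  qed
  have t_nonneg: "t i \<ge> 0" for i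
    using order_trans[OF norm_ge_zero norm_gbinomial_le[OF v, of i]] by (simp add: t_def)
  have "(\<lambda>i. (v gchoose i) * u ^ i) sums (1 + u) powr v"
    using u by (intro gen_binomial_complex) auto
  from sums_split_initial_segment[OF this, of "Suc n"]
  have rem: "(\<lambda>i. (v gchoose (i + Suc n)) * u ^ (i + Suc n)) sums
               ((1 + u) powr v - (\<Sum>i\<le>n. (v gchoose i) * u ^ i))"
    by (simp add: lessThan_Suc_atMost)
  have bound: "norm ((v gchoose (i + Suc n)) * u ^ (i + Suc n))
                 \<le> t (i + Suc n) * (2 * norm u) ^ Suc n" for i
  proof -
    have "norm u ^ (i + Suc n) = (1 / 2) ^ (i + Suc n) * ((2 * norm u) ^ i * (2 * norm u) ^ Suc n)"
      by (simp only: power_add[symmetric] power_mult_distrib[symmetric]) simp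
    also have "\<dots> \<le> (1 / 2) ^ (i + Suc n) * (1 * (2 * norm u) ^ Suc n)"
      using u by (intro mult_left_mono mult_right_mono power_le_one) auto
    finally have "norm u ^ (i + Suc n) \<le> (1 / 2) ^ (i + Suc n) * (2 * norm u) ^ Suc n"
      by simp
    moreover have "0 \<le> (- 1) ^ (i + Suc n) * ((- M) gchoose (i + Suc n))"
      by (rule order_trans[OF norm_ge_zero norm_gbinomial_le[OF v]])
    ultimately have "norm (v gchoose (i + Suc n)) * norm u ^ (i + Suc n)
        \<le> ((- 1) ^ (i + Suc n) * ((- M) gchoose (i + Suc n))) *
          ((1 / 2) ^ (i + Suc n) * (2 * norm u) ^ Suc n)"
      by (intro mult_mono norm_gbinomial_le[OF v]) auto
    thus ?thesis
      by (simp add: t_def norm_mult norm_power mult_ac)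
  qed
  have smb: "summable (\<lambda>i. t (i + Suc n) * (2 * norm u) ^ Suc n)"
    by (intro summable_mult2 summable_ignore_initial_segment[OF sums_summable[OF t]])
  have "norm ((1 + u) powr v - (\<Sum>i\<le>n. (v gchoose i) * u ^ i))
      = norm (\<Sum>i. (v gchoose (i + Suc n)) * u ^ (i + Suc n))"
    using rem by (simp add: sums_iff)
  also have "\<dots> \<le> (\<Sum>i. t (i + Suc n) * (2 * norm u) ^ Suc n)"
    by (rule norm_suminf_le[OF bound smb])
  also have "\<dots> = (\<Sum>i. t (i + Suc n)) * (2 * norm u) ^ Suc n"
    by (intro suminf_mult2[symmetric] summable_ignore_initial_segment[OF sums_summable[OF t]])
  also have "(\<Sum>i. t (i + Suc n)) \<le> suminf t"
    using suminf_split_initial_segment[OF sums_summable[OF t], of "Suc n"]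
          sum_nonneg[of "{..<Suc n}" t] t_nonneg by auto
  finally show ?thesis
    using t by (simp add: sums_iff mult_right_mono)
qed

section \<open>Bernoulli polynomials\<close>

text \<open>
  The quotient in the definition of the Bernoulli polynomials is exact because
  \<open>e\<^sup>x - 1\<close> has subdegree 1.  Division of power series is a truncated operation in
  general, so the exactness has to be established before the factor \<open>fps_exp a\<close>
  can be taken out of it.
\<close>

lemma fps_bernpoly:
  "fps_X * fps_exp a / (fps_exp 1 - 1) = (fps_X / (fps_exp 1 - 1)) * fps_exp (a::complex)"
  and fps_bernpoly_times: "(fps_X / (fps_exp 1 - 1)) * (fps_exp 1 - 1) = (fps_X :: complex fps)"
proof -
  have nz: "fps_exp 1 - 1 \<noteq> (0 :: complex fps)"
    by (metis fps_exp_nth fps_exp_0 fps_exp_eq_iff right_minus_eq zero_neq_one)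
  have "subdegree (fps_exp 1 - 1 :: complex fps) \<le> 1"
    by (rule subdegree_leI) simp
  moreover have "subdegree (fps_X :: complex fps) = 1" by simp
  ultimately have "(fps_exp 1 - 1 :: complex fps) dvd fps_X"
    using nz by (simp add: fps_dvd_iff)
  thus *: "(fps_X / (fps_exp 1 - 1)) * (fps_exp 1 - 1) = (fps_X :: complex fps)"
    by simp
  have "fps_X * fps_exp a = (fps_X / (fps_exp 1 - 1) * fps_exp a) * (fps_exp 1 - 1)"
    using * by (metis mult.assoc mult.commute)
  thus "fps_X * fps_exp a / (fps_exp 1 - 1) = (fps_X / (fps_exp 1 - 1)) * fps_exp a"
    using nz by (metis nonzero_mult_div_cancel_right)
qed

lemma bernpoly_conv_sum:
  "bernpoly n a = (\<Sum>j\<le>n. bernpoly j 0 * of_nat (n choose j) * a ^ (n - j))"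
proof -
  have b: "bernpoly j 0 = fact j * fps_nth (fps_X / (fps_exp 1 - 1)) j" for j
    by (simp add: bernpoly_def)
  show ?thesis
    unfolding bernpoly_def[of n] fps_bernpoly fps_mult_nth b sum_distrib_left atLeast0AtMost
    by (intro sum.cong refl) (auto simp: binomial_fact field_simps)
qed

text \<open>
  Replacing \<open>a\<close> by \<open>a + 1\<close> multiplies the generating function by \<open>fps_exp 1\<close>, so the
  difference has the factor \<open>fps_exp 1 - 1\<close>, which cancels the denominator.
\<close>

lemma bernpoly_diff: "bernpoly n (a + 1) - bernpoly n a = of_nat n * a ^ (n - 1)"
proof -
  let ?Q = "fps_X / (fps_exp 1 - 1) :: complex fps"
  have "?Q * fps_exp (a + 1) - ?Q * fps_exp a = (?Q * (fps_exp 1 - 1)) * fps_exp a"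
    by (simp add: fps_exp_add_mult algebra_simps)
  also have "\<dots> = fps_X * fps_exp a"
    by (simp only: fps_bernpoly_times)
  finally have "fact n * fps_nth (?Q * fps_exp (a + 1) - ?Q * fps_exp a) n =
      fact n * fps_nth (fps_X * fps_exp a) n"
    by (rule arg_cong)
  hence "bernpoly n (a + 1) - bernpoly n a = fact n * fps_nth (fps_X * fps_exp a) n"
    unfolding bernpoly_def fps_bernpoly fps_sub_nth right_diff_distrib .
  also have "\<dots> = of_nat n * a ^ (n - 1)"
    by (cases n) simp_all
  finally show ?thesis .
qed

text \<open>
  The recurrence that determines the Bernoulli numbers; it is the difference equation
  at \<open>a = 0\<close>, where \<open>n * 0 ^ (n - 1)\<close> is 1 exactly for \<open>n = 1\<close>.
\<close>

lemma sum_binomial_bernoulli: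
  "(\<Sum>j<n. bernpoly j 0 * of_nat (n choose j)) = (if n = 1 then 1 else 0)"
proof -
  have "bernpoly n 1 = (\<Sum>j<n. bernpoly j 0 * of_nat (n choose j)) + bernpoly n 0"
    by (subst bernpoly_conv_sum) (simp add: lessThan_Suc_atMost[symmetric])
  with bernpoly_diff[of n 0] show ?thesis
    by (auto simp: power_0_left split: if_splits)
qed

section \<open>An approximate solution of the difference equation\<close>

text \<open>
  A principal power differs in modulus from the real power only by
  \<open>exp (- Im w * Arg x)\<close>, and \<open>\<bar>Arg x\<bar> \<le> \<pi>\<close>.
\<close>

lemma norm_powr_le:
  fixes x w :: complex
  assumes "norm w \<le> M"
  shows "norm (x powr w) \<le> norm x powr Re w * exp (M * pi)"
proof -
  have "- Im w * Arg x \<le> \<bar>Im w\<bar> * \<bar>Arg x\<bar>"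
    by (metis abs_ge_self abs_mult abs_minus_cancel)
  also have "\<dots> \<le> M * pi"
    using abs_Im_le_cmod[of w] assms Arg_le_pi[of x] mpi_less_Arg[of x]
    by (intro mult_mono) auto
  finally show ?thesis
    by (auto simp: norm_powr_complex intro!: mult_left_mono)
qed

text \<open>
  Both \<open>x\<close> and \<open>1 + 1/x\<close> lie in the right half-plane, so their arguments add up to
  something strictly between \<open>- \<pi>\<close> and \<open>\<pi>\<close> and no branch correction occurs.
\<close>

lemma powr_add_one:
  fixes x :: complex
  assumes x: "Re x > 0" "norm x \<ge> 2"
  shows "(x + 1) powr v = x powr v * (1 + 1 / x) powr v"
proof -
  have nz: "x \<noteq> 0" using x by auto
  have "\<bar>Re (1 / x)\<bar> \<le> norm (1 / x)" by (rule abs_Re_le_cmod)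
  also have "\<dots> \<le> 1 / 2" using x frac_le[of 1 1 2 "norm x"] by (simp add: norm_divide)
  finally have r: "Re (1 + 1 / x) > 0" by simp
  have nz': "1 + 1 / x \<noteq> 0" using r by (metis less_irrefl zero_complex.simps(1))
  have "\<bar>Im (Ln x)\<bar> < pi / 2" "\<bar>Im (Ln (1 + 1 / x))\<bar> < pi / 2"
    using Re_Ln_pos_lt[OF nz] Re_Ln_pos_lt[OF nz'] x r by blast+
  hence "Ln (x * (1 + 1 / x)) = Ln x + Ln (1 + 1 / x)"
    using nz nz' by (intro Ln_times_simple) (auto simp: abs_less_iff)
  moreover have "x * (1 + 1 / x) = x + 1"
    using nz by (simp add: field_simps)
  ultimately have "Ln (x + 1) = Ln x + Ln (1 + 1 / x)" "x + 1 \<noteq> 0"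
    using x by (auto simp: complex_eq_iff)
  thus ?thesis
    using nz nz' by (simp add: powr_def exp_add ring_distribs)
qed

text \<open>
  For \<open>w = n \<le> N\<close> and \<open>x \<noteq> 0\<close> this is the Bernoulli polynomial of degree \<open>n\<close>; for other \<open>w\<close> it is
  a truncation of the asymptotic series of \<open>- w \<zeta>(1 - w, x)\<close> for large \<open>x\<close>.
\<close>

definition bern_approx :: "nat \<Rightarrow> complex \<Rightarrow> complex \<Rightarrow> complex" where
  "bern_approx N w x = (\<Sum>j\<le>N. bernpoly j 0 * (w gchoose j) * x powr (w - of_nat j))"

text \<open>
  The defect of the truncation in the difference equation
  \<open>B\<^sub>w(x + 1) - B\<^sub>w(x) = w * x powr (w - 1)\<close>.
\<close>

definition bern_step :: "nat \<Rightarrow> complex \<Rightarrow> complex \<Rightarrow> complex" where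
  "bern_step N w x = bern_approx N w (x + 1) - bern_approx N w x - w * x powr (w - 1)"

text \<open>
  Collecting powers of \<open>u\<close>, the coefficient of \<open>u\<^sup>n\<close> is a sum over \<open>j < n\<close> of
  \<open>B\<^sub>j (w gchoose j) (w - j gchoose n - j)\<close>.  Trinomial revision turns this into
  \<open>(w gchoose n)\<close> times the sum of \<open>B\<^sub>j (n choose j)\<close>, which is 0 unless \<open>n = 1\<close>.
\<close>

lemma bernoulli_binomial_cancel:
  "(\<Sum>j\<le>N. bernpoly j 0 * (w gchoose j) * u ^ j *
      ((\<Sum>i\<le>Suc N - j. ((w - of_nat j) gchoose i) * u ^ i) - 1)) = w * u"
proof -
  define g where "g n j = bernpoly j 0 * (w gchoose j) * ((w - of_nat j) gchoose (n - j)) * u ^ n"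
    for n j
  have "(\<Sum>j\<le>N. bernpoly j 0 * (w gchoose j) * u ^ j *
      ((\<Sum>i\<le>Suc N - j. ((w - of_nat j) gchoose i) * u ^ i) - 1)) =
      (\<Sum>j<Suc N. \<Sum>n = Suc j..Suc N. g n j)"
    unfolding lessThan_Suc_atMost
  proof (intro sum.cong refl)
    fix j assume j: "j \<in> {..N}"
    have "(\<Sum>i\<le>Suc N - j. ((w - of_nat j) gchoose i) * u ^ i) - 1
        = (\<Sum>i=1..Suc N - j. ((w - of_nat j) gchoose i) * u ^ i)"
      by (simp add: atMost_atLeast0 sum.atLeast_Suc_atMost)
    hence "bernpoly j 0 * (w gchoose j) * u ^ j *
        ((\<Sum>i\<le>Suc N - j. ((w - of_nat j) gchoose i) * u ^ i) - 1) =
        (\<Sum>i=1..Suc N - j. g (i + j) j)"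
      by (simp add: g_def sum_distrib_left power_add mult_ac)
    also have "\<dots> = (\<Sum>n = Suc j..Suc N. g n j)"
      using j sum.shift_bounds_cl_nat_ivl[of "\<lambda>n. g n j" 1 j "Suc N - j"] by simp
    finally show "bernpoly j 0 * (w gchoose j) * u ^ j *
        ((\<Sum>i\<le>Suc N - j. ((w - of_nat j) gchoose i) * u ^ i) - 1) =
        (\<Sum>n = Suc j..Suc N. g n j)" .
  qed
  also have "\<dots> = (\<Sum>n\<le>Suc N. \<Sum>j<n. g n j)"
    by (rule sum.nested_swap'[symmetric])
  also have "\<dots> = (\<Sum>n\<le>Suc N. if n = 1 then w * u else 0)"
  proof (intro sum.cong refl)
    fix n
    have "(\<Sum>j<n. g n j) =
        (\<Sum>j<n. (w gchoose n) * u ^ n * (bernpoly j 0 * of_nat (n choose j)))"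
      using gbinomial_trinomial_revision[of _ n w]
      by (intro sum.cong refl) (simp add: g_def binomial_gbinomial mult_ac)
    also have "\<dots> = (w gchoose n) * u ^ n * (\<Sum>j<n. bernpoly j 0 * of_nat (n choose j))"
      by (rule sum_distrib_left[symmetric])
    finally show "(\<Sum>j<n. g n j) = (if n = 1 then w * u else 0)"
      unfolding sum_binomial_bernoulli by auto
  qed
  also have "\<dots> = w * u"
    by (subst sum.delta) auto
  finally show ?thesis .
qed

text \<open>
  With \<open>u = 1/x\<close> the defect is \<open>x powr w\<close> times an expression in \<open>u\<close> and the powers
  \<open>(1 + u) powr (w - j)\<close>.  Expanding these binomially up to total degree \<open>N + 1\<close> in \<open>u\<close>,
  everything cancels by the previous lemma, and the remainders contribute
  \<open>O(\<bar>u\<bar> ^ (N + 2))\<close>, uniformly for bounded \<open>w\<close>.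
\<close>

lemma norm_bern_step_le:
  obtains C where "C \<ge> 0"
    "\<And>w x. norm w \<le> M \<Longrightarrow> Re x > 0 \<Longrightarrow> norm x \<ge> 2 \<Longrightarrow>
       norm (bern_step N w x) \<le> C * norm x powr (Re w - real (N + 2))"
proof
  \<comment> \<open>The \<open>j\<close>-th remainder has exponent \<open>w - j\<close> with \<open>norm (w - j) \<le> M + N\<close>; the factor \<open>exp (M * pi)\<close>
    bounds the modulus of \<open>x powr w\<close> relative to \<open>norm x powr Re w\<close>.\<close>
  define K where "K = (\<Sum>j\<le>N. norm (bernpoly j 0) * \<bar>(- M) gchoose j\<bar> *
                     (2 powr (M + real N) * 2 ^ (N + 2)))"
  show K: "K * exp (M * pi) \<ge> 0"
    unfolding K_def by (intro mult_nonneg_nonneg sum_nonneg) auto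
  fix w x :: complex
  assume w: "norm w \<le> M" and x: "Re x > 0" "norm x \<ge> 2"
  define u where "u = 1 / x"
  have nz: "x \<noteq> 0" and u: "norm u \<le> 1 / 2"
    using x frac_le[of 1 1 2 "norm x"] by (auto simp: u_def norm_divide)
  define c where "c j = bernpoly j 0 * (w gchoose j)" for j
  define P where "P j = (\<Sum>i\<le>Suc N - j. ((w - of_nat j) gchoose i) * u ^ i)" for j
  have pw: "x powr (w - of_nat j) = x powr w * u ^ j" for j
    using nz by (simp add: powr_diff powr_nat' u_def power_one_over)
  have "bern_step N w x = x powr w * ((\<Sum>j\<le>N. c j * u ^ j * ((1 + u) powr (w - of_nat j) - 1)) - w * u)"
  proof -
    have "bern_approx N w (x + 1) = x powr w * (\<Sum>j\<le>N. c j * u ^ j * (1 + u) powr (w - of_nat j))"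
      unfolding bern_approx_def sum_distrib_left
      by (intro sum.cong refl) (simp only: powr_add_one[OF x] pw c_def u_def mult_ac)
    moreover have "bern_approx N w x = x powr w * (\<Sum>j\<le>N. c j * u ^ j)"
      unfolding bern_approx_def sum_distrib_left
      by (intro sum.cong refl) (simp only: pw c_def mult_ac)
    moreover have "w * x powr (w - 1) = x powr w * (w * u)"
      using pw[of 1] by simp
    ultimately show ?thesis
      by (simp only: bern_step_def right_diff_distrib sum_subtractf mult_1_right)
  qed
  also have "w * u = (\<Sum>j\<le>N. c j * u ^ j * (P j - 1))"
    by (simp add: c_def P_def bernoulli_binomial_cancel)
  also have "(\<Sum>j\<le>N. c j * u ^ j * ((1 + u) powr (w - of_nat j) - 1)) - \<dots> =
             (\<Sum>j\<le>N. c j * u ^ j * ((1 + u) powr (w - of_nat j) - P j))"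
    unfolding sum_subtractf[symmetric] by (intro sum.cong refl) (simp only: algebra_simps)
  finally have step: "bern_step N w x =
      x powr w * (\<Sum>j\<le>N. c j * u ^ j * ((1 + u) powr (w - of_nat j) - P j))" .
  have "norm (\<Sum>j\<le>N. c j * u ^ j * ((1 + u) powr (w - of_nat j) - P j)) \<le>
        (\<Sum>j\<le>N. norm (bernpoly j 0) * \<bar>(- M) gchoose j\<bar> *
                     (2 powr (M + real N) * 2 ^ (N + 2)) * norm u ^ (N + 2))"
  proof (intro sum_norm_le)
    fix j assume j: "j \<in> {..N}"
    have c: "norm (c j) \<le> norm (bernpoly j 0) * \<bar>(- M) gchoose j\<bar>"
    proof -
      have "norm (w gchoose j) \<le> \<bar>(- M) gchoose j\<bar>"
        using order_trans[OF norm_gbinomial_le[OF w, of j] abs_ge_self] by (simp add: abs_mult)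
      thus ?thesis by (simp add: c_def norm_mult mult_left_mono)
    qed
    have "norm (w - of_nat j) \<le> M + real N"
      using norm_triangle_ineq4[of w "of_nat j"] w j by simp
    from norm_binomial_remainder_le[OF this u, of "Suc N - j"]
    have "norm u ^ j * norm ((1 + u) powr (w - of_nat j) - P j) \<le>
          norm u ^ j * (2 powr (M + real N) * (2 * norm u) ^ Suc (Suc N - j))"
      unfolding P_def by (intro mult_left_mono) auto
    also have "\<dots> = 2 powr (M + real N) * 2 ^ Suc (Suc N - j) *
                    (norm u ^ j * norm u ^ Suc (Suc N - j))"
      by (simp add: power_mult_distrib mult_ac)
    also have "norm u ^ j * norm u ^ Suc (Suc N - j) = norm u ^ (N + 2)"
      using j by (subst power_add[symmetric]) (simp add: Suc_diff_le)
    also have "2 powr (M + real N) * 2 ^ Suc (Suc N - j) * norm u ^ (N + 2) \<le>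
               2 powr (M + real N) * 2 ^ (N + 2) * norm u ^ (N + 2)"
      by (intro mult_right_mono mult_left_mono power_increasing) auto
    finally have "norm (c j) * (norm u ^ j * norm ((1 + u) powr (w - of_nat j) - P j)) \<le>
        (norm (bernpoly j 0) * \<bar>(- M) gchoose j\<bar>) *
        (2 powr (M + real N) * 2 ^ (N + 2) * norm u ^ (N + 2))"
      by (rule mult_mono[OF c]) auto
    thus "norm (c j * u ^ j * ((1 + u) powr (w - of_nat j) - P j)) \<le>
        norm (bernpoly j 0) * \<bar>(- M) gchoose j\<bar> *
                     (2 powr (M + real N) * 2 ^ (N + 2)) * norm u ^ (N + 2)"
      by (simp add: norm_mult norm_power mult_ac)
  qed
  also have "\<dots> = K * norm u ^ (N + 2)"
    by (simp only: K_def sum_distrib_right)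
  finally have "norm (bern_step N w x) \<le>
      (norm x powr Re w * exp (M * pi)) * (K * norm u ^ (N + 2))"
    unfolding step norm_mult by (intro mult_mono norm_powr_le w) auto
  also have "norm u ^ (N + 2) = norm x powr (- real (N + 2))"
    unfolding u_def using nz powr_realpow[of "norm x" "N + 2"]
    by (simp only: powr_minus norm_divide norm_one power_one_over inverse_eq_divide) simp
  also have "(norm x powr Re w * exp (M * pi)) * (K * norm x powr (- real (N + 2))) =
      K * exp (M * pi) * (norm x powr Re w * norm x powr (- real (N + 2)))"
    by (simp only: mult_ac)
  also have "norm x powr Re w * norm x powr (- real (N + 2)) = norm x powr (Re w - real (N + 2))"
    by (simp only: powr_add[symmetric] add_uminus_conv_diff)
  finally show "norm (bern_step N w x) \<le> K * exp (M * pi) * norm x powr (Re w - real (N + 2))" .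
qed

section \<open>The Bernoulli function of complex degree\<close>

text \<open>
  Partial sums of the series for \<open>- w \<zeta>(1 - w, a)\<close>, regularised by adding the
  truncated asymptotic expansion of the missing tail.
\<close>

definition bern_partial :: "nat \<Rightarrow> complex \<Rightarrow> complex \<Rightarrow> nat \<Rightarrow> complex" where
  "bern_partial N w a R =
     bern_approx N w (of_nat R + a) - w * (\<Sum>r<R. (of_nat r + a) powr (w - 1))"

lemma bern_partial_conv_sum:
  "bern_partial N w a R = bern_approx N w a + (\<Sum>r<R. bern_step N w (of_nat r + a))"
  by (induction R) (auto simp: bern_partial_def bern_step_def algebra_simps)

text \<open>
  By telescoping, the regularised partial sums are partial sums of the series of
  defects.  These are \<open>O(r powr (Re w - N - 2))\<close>, which is summable as long as
  \<open>Re w < N + 1\<close>.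
\<close>

lemma uniform_limit_bern_partial:
  assumes w0: "Re w0 < real N + 1"
  obtains d where "d > 0" "cball w0 d \<subseteq> {w. Re w < real N + 1}"
    "uniform_limit (cball w0 d) (\<lambda>R w. bern_partial N w a R)
       (\<lambda>w. lim (bern_partial N w a)) sequentially"
proof
  \<comment> \<open>Half the distance to the boundary line keeps the exponents \<open>Re w - N - 2\<close> at most \<open>- 1 - d\<close> on the disc.\<close>
  define d where "d = (real N + 1 - Re w0) / 2"
  show d: "d > 0" using w0 by (simp add: d_def)
  have Re_le: "Re w \<le> real N + 1 - d" if "w \<in> cball w0 d" for w
  proof -
    have "Re w - Re w0 \<le> norm (w - w0)"
      using complex_Re_le_cmod[of "w - w0"] by simp
    also have "\<dots> \<le> d"
      using that by (simp add: dist_norm norm_minus_commute)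
    finally show ?thesis by (simp add: d_def field_simps)
  qed
  show "cball w0 d \<subseteq> {w. Re w < real N + 1}"
    using d Re_le by fastforce
  obtain C where C: "C \<ge> 0"
    "\<And>w x. norm w \<le> norm w0 + d \<Longrightarrow> Re x > 0 \<Longrightarrow> norm x \<ge> 2 \<Longrightarrow>
       norm (bern_step N w x) \<le> C * norm x powr (Re w - real (N + 2))"
    using norm_bern_step_le[of "norm w0 + d" N] by blast
  have "uniform_limit (cball w0 d) (\<lambda>R w. \<Sum>r<R. bern_step N w (of_nat r + a))
          (\<lambda>w. \<Sum>r. bern_step N w (of_nat r + a)) sequentially"
  proof (rule Weierstrass_m_test_ev)
    show "summable (\<lambda>r. C * 2 powr (1 + d) * of_nat r powr (- 1 - d))"
      using d by (intro summable_mult) (simp add: summable_real_powr_iff)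
    show "\<forall>\<^sub>F r in sequentially. \<forall>w\<in>cball w0 d.
        norm (bern_step N w (of_nat r + a)) \<le> C * 2 powr (1 + d) * of_nat r powr (- 1 - d)"
      \<comment> \<open>From this index on, \<open>r + a\<close> is in the right half-plane, with modulus at least \<open>r/2 \<ge> 2\<close>.\<close>
      using eventually_ge_at_top[of "nat \<lceil>2 * norm a + 4\<rceil>"]
    proof eventually_elim
      case (elim r)
      hence r: "real r \<ge> 2 * norm a + 4" by linarith
      hence r_pos: "real r > 0" using norm_ge_zero[of a] by linarith
      let ?x = "of_nat r + a"
      have x: "norm ?x \<ge> real r / 2" "norm ?x \<ge> 2" "Re ?x > 0"
        using norm_triangle_ineq2[of "of_nat r" "- a"] abs_Re_le_cmod[of a] r by (auto simp: abs_le_iff)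
      show ?case
      proof
        fix w assume w: "w \<in> cball w0 d"
        have "norm w \<le> norm w0 + d"
          using w norm_triangle_ineq2[of w w0] by (simp add: dist_norm norm_minus_commute)
        with x have "norm (bern_step N w ?x) \<le> C * norm ?x powr (Re w - real (N + 2))"
          by (intro C)
        also have "\<dots> \<le> C * norm ?x powr (- 1 - d)"
          using x Re_le[OF w] by (intro mult_left_mono C powr_mono) auto
        also have "\<dots> \<le> C * (real r / 2) powr (- 1 - d)"
          using x r_pos d by (intro mult_left_mono C powr_mono2') auto
        also have "(real r / 2) powr (- 1 - d) = 2 powr (1 + d) * real r powr (- 1 - d)"
          using powr_minus_divide[of 2 "1 + d"]
          by (simp add: powr_divide algebra_simps)
        finally show "norm (bern_step N w ?x) \<le> C * 2 powr (1 + d) * of_nat r powr (- 1 - d)"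
          by (simp add: mult_ac)
      qed
    qed
  qed
  from uniform_limit_add[OF uniform_limit_const this, of "\<lambda>w. bern_approx N w a"]
  have *: "uniform_limit (cball w0 d) (\<lambda>R w. bern_partial N w a R)
     (\<lambda>w. bern_approx N w a + (\<Sum>r. bern_step N w (of_nat r + a))) sequentially"
    unfolding bern_partial_conv_sum .
  have "lim (bern_partial N w a) = bern_approx N w a + (\<Sum>r. bern_step N w (of_nat r + a))"
    if "w \<in> cball w0 d" for w
    using tendsto_uniform_limitI[OF * that] by (rule limI)
  with * show "uniform_limit (cball w0 d) (\<lambda>R w. bern_partial N w a R)
       (\<lambda>w. lim (bern_partial N w a)) sequentially"
    by (subst uniform_limit_cong'[OF refl]) auto
qed

lemma powr_of_nat_plus_tendsto_0:
  assumes "Re v < 0"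
  shows "(\<lambda>R. (of_nat R + a) powr v) \<longlonglongrightarrow> (0 :: complex)"
proof (rule Lim_null_comparison)
  show "\<forall>\<^sub>F R in sequentially. norm ((of_nat R + a) powr v) \<le>
          norm (of_nat R + a) powr Re v * exp (norm v * pi)"
    by (intro always_eventually allI norm_powr_le order_refl)
  have "filterlim (\<lambda>R. norm (of_nat R + a)) at_top sequentially"
    using tendsto_add_filterlim_at_infinity'[OF tendsto_of_nat tendsto_const, of a]
    by (simp add: filterlim_at_infinity_conv_norm_at_top)
  from tendsto_mult_left_zero[OF tendsto_neg_powr[OF assms this]]
  show "(\<lambda>R. norm (of_nat R + a) powr Re v * exp (norm v * pi)) \<longlonglongrightarrow> 0" .
qed

text \<open>
  The Bernoulli function \<open>B\<^sub>w(a)\<close> of complex degree \<open>w\<close>, equal to \<open>- w \<zeta>(1 - w, a)\<close>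
  when \<open>a\<close> is not a nonpositive integer.  The order \<open>N = \<lfloor>Re w\<rfloor>\<close> is the least one in the range
  \<open>Re w < N + 1\<close> of convergence (for \<open>Re w \<ge> 0\<close>); any larger order gives the same limit.
\<close>

definition bern_fun :: "complex \<Rightarrow> complex \<Rightarrow> complex" where
  "bern_fun w a = lim (bern_partial (nat \<lfloor>Re w\<rfloor>) w a)"

text \<open>
  Raising the order from \<open>n\<close> to \<open>N\<close> adds terms in \<open>R + a\<close> with exponents \<open>w - j\<close>,
  \<open>j \<ge> n + 1 > Re w\<close>, which vanish as \<open>R\<close> tends to infinity.
\<close>

lemma bern_partial_tendsto:
  assumes "Re w < real N + 1"
  shows "bern_partial N w a \<longlonglongrightarrow> bern_fun w a"
proof -
  define n where "n = nat \<lfloor>Re w\<rfloor>"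
  have n: "Re w < real n + 1" "n \<le> N"
    using assms unfolding n_def by linarith+
  obtain d where "d > 0" "uniform_limit (cball w d) (\<lambda>R w. bern_partial n w a R)
       (\<lambda>w. lim (bern_partial n w a)) sequentially"
    using uniform_limit_bern_partial[OF n(1)] by blast
  hence lim_n: "bern_partial n w a \<longlonglongrightarrow> bern_fun w a"
    unfolding bern_fun_def n_def[symmetric] by (intro tendsto_uniform_limitI[where S = "cball w d"]) auto
  have "bern_partial N w a R = bern_partial n w a R +
      (\<Sum>j = Suc n..N. bernpoly j 0 * (w gchoose j) * (of_nat R + a) powr (w - of_nat j))" for R
    using n(2) sum_up_index_split[of _ n "N - n"]
    by (simp add: bern_partial_def bern_approx_def)
  hence "bern_partial N w a = (\<lambda>R. bern_partial n w a R +
      (\<Sum>j = Suc n..N. bernpoly j 0 * (w gchoose j) * (of_nat R + a) powr (w - of_nat j)))"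
    by (rule ext)
  moreover have "(\<lambda>R. bern_partial n w a R +
      (\<Sum>j = Suc n..N. bernpoly j 0 * (w gchoose j) * (of_nat R + a) powr (w - of_nat j)))
      \<longlonglongrightarrow> bern_fun w a + 0"
    using n by (intro tendsto_add lim_n tendsto_null_sum tendsto_mult_right_zero
        powr_of_nat_plus_tendsto_0) auto
  ultimately show ?thesis by simp
qed

text \<open>
  On each half-plane \<open>Re w < N + 1\<close> one fixed order \<open>N\<close> may be used, and there the
  function is a locally uniform limit of entire functions of \<open>w\<close>.
\<close>

lemma holomorphic_bern_fun: "(\<lambda>w. bern_fun w a) holomorphic_on UNIV"
proof -
  have "(\<lambda>w. bern_fun w a) holomorphic_on {w. Re w < real N + 1}" for N
  proof (rule holomorphic_uniform_sequence)
    show "open {w. Re w < real N + 1}" by (rule open_halfspace_Re_lt)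
    show "(\<lambda>w. bern_partial N w a R) holomorphic_on {w. Re w < real N + 1}" for R
      unfolding bern_partial_def bern_approx_def gbinomial_prod_rev
      by (intro holomorphic_intros) auto
    fix w0 assume "w0 \<in> {w. Re w < real N + 1}"
    hence "Re w0 < real N + 1" by simp
    from uniform_limit_bern_partial[OF this, of a] obtain d where d: "d > 0"
      "cball w0 d \<subseteq> {w. Re w < real N + 1}"
      "uniform_limit (cball w0 d) (\<lambda>R w. bern_partial N w a R)
       (\<lambda>w. lim (bern_partial N w a)) sequentially" by blast
    have "lim (bern_partial N w a) = bern_fun w a" if "w \<in> cball w0 d" for w
      using bern_partial_tendsto[of w N a] d(2) that by (intro limI) auto
    hence "uniform_limit (cball w0 d) (\<lambda>R w. bern_partial N w a R) (\<lambda>w. bern_fun w a) sequentially"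
      using d(3) by (subst (asm) uniform_limit_cong'[OF refl]) auto
    with d show "\<exists>d>0. cball w0 d \<subseteq> {w. Re w < real N + 1} \<and>
      uniform_limit (cball w0 d) (\<lambda>R w. bern_partial N w a R) (\<lambda>w. bern_fun w a) sequentially"
      by blast
  qed
  hence "(\<lambda>w. bern_fun w a) holomorphic_on (\<Union>N. {w. Re w < real N + 1})"
    by (intro holomorphic_on_UN_open open_halfspace_Re_lt)
  moreover have "(\<Union>N. {w. Re w < real N + 1}) = UNIV"
  proof (rule UNIV_eq_I[symmetric])
    fix w :: complex
    have "Re w < real (nat \<lfloor>Re w\<rfloor>) + 1" by linarith
    thus "w \<in> (\<Union>N. {w. Re w < real N + 1})" by blast
  qed
  ultimately show ?thesis by simp
qed

section \<open>Values of the Bernoulli function\<close>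

lemma of_nat_add_neq_0:
  fixes a :: complex
  assumes "a \<notin> \<int>\<^sub>\<le>\<^sub>0"
  shows "of_nat r + a \<noteq> 0"
proof
  assume "of_nat r + a = 0"
  hence "a = - of_nat r" by (simp add: eq_neg_iff_add_eq_0 add.commute)
  with assms show False by simp
qed

text \<open>
  For \<open>w = n\<close> the truncation of order \<open>n\<close> is a Bernoulli polynomial and satisfies the
  difference equation exactly, so the regularised partial sums do not depend on \<open>R\<close>.
\<close>

lemma bern_fun_of_nat:
  assumes "a \<notin> \<int>\<^sub>\<le>\<^sub>0"
  shows "bern_fun (of_nat n) a = bernpoly n a"
proof -
  note nz = of_nat_add_neq_0[OF assms]
  have approx: "bern_approx n (of_nat n) x = bernpoly n x" if "x \<noteq> 0" for x
    unfolding bern_approx_def bernpoly_conv_sum[of n]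
  proof (intro sum.cong refl)
    fix j assume "j \<in> {..n}"
    hence "x powr (of_nat n - of_nat j) = x ^ (n - j)"
      using that by (simp add: powr_nat' flip: of_nat_diff)
    thus "bernpoly j 0 * (of_nat n gchoose j) * x powr (of_nat n - of_nat j) =
          bernpoly j 0 * of_nat (n choose j) * x ^ (n - j)"
      by (simp add: binomial_gbinomial)
  qed
  have step: "bern_step n (of_nat n) (of_nat r + a) = 0" for r
  proof -
    \<comment> \<open>For \<open>n = 0\<close> the exponents differ (\<open>n - 1\<close> is truncated on the right), but the factor \<open>n\<close> vanishes.\<close>
    have "of_nat n * (of_nat r + a) powr (of_nat n - 1) = of_nat n * (of_nat r + a) ^ (n - 1)"
      using nz[of r] by (cases n) (auto simp: powr_nat')
    moreover have nz': "of_nat r + a + 1 \<noteq> 0"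
      using nz[of "Suc r"] by (simp add: add_ac)
    ultimately show ?thesis
      using bernpoly_diff[of n "of_nat r + a"]
      unfolding bern_step_def by (simp only: approx[OF nz[of r]] approx[OF nz']) simp
  qed
  have "bern_partial n (of_nat n) a = (\<lambda>_. bernpoly n a)"
    using approx[of a] nz[of 0] by (simp add: fun_eq_iff bern_partial_conv_sum step)
  moreover have "bern_partial n (of_nat n) a \<longlonglongrightarrow> bern_fun (of_nat n) a"
    by (rule bern_partial_tendsto) simp
  ultimately show ?thesis
    using LIMSEQ_unique tendsto_const by metis
qed

text \<open>
  In the half-plane of convergence of the series the regularising term of order 0, a
  multiple of \<open>(R + a) powr w\<close>, tends to 0.
\<close>

lemma hurwitz_sums_bern_fun:
  assumes "Re w < 0"
  shows "(\<lambda>r. (of_nat r + a) powr (w - 1)) sums (- bern_fun w a / w)"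
proof -
  have w: "w \<noteq> 0" using assms by auto
  have "bern_partial 0 w a \<longlonglongrightarrow> bern_fun w a"
    using assms by (intro bern_partial_tendsto) simp
  moreover have "(\<lambda>R. bern_approx 0 w (of_nat R + a)) \<longlonglongrightarrow> 0"
    using tendsto_mult_right_zero[OF powr_of_nat_plus_tendsto_0[OF assms]] by (simp add: bern_approx_def)
  ultimately have "(\<lambda>R. (bern_approx 0 w (of_nat R + a) - bern_partial 0 w a R) / w) \<longlonglongrightarrow>
      (0 - bern_fun w a) / w"
    using w by (intro tendsto_intros)
  thus ?thesis
    using w by (simp add: sums_def bern_partial_def)
qed

section \<open>The series of augmented triangular numbers\<close>

text \<open>
  With \<open>x = r + a\<close>, so \<open>r = x - a\<close>, the augmented triangular number is a quadratic
  polynomial in \<open>x\<close>, and the series splits into three Hurwitz series.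
\<close>

lemma aug_series_conv_bern_fun:
  assumes a: "a \<notin> \<int>\<^sub>\<le>\<^sub>0" and s: "Re s > 3"
  shows "aug_series k s a =
    - of_real (\<alpha> k) * bern_fun (3 - s) a / (3 - s)
    - (of_real (\<beta> k) - 2 * a * of_real (\<alpha> k)) * bern_fun (2 - s) a / (2 - s)
    - (1 - a * of_real (\<beta> k) + a\<^sup>2 * of_real (\<alpha> k)) * bern_fun (1 - s) a / (1 - s)"
proof -
  let ?c2 = "of_real (\<alpha> k) :: complex"
  let ?c1 = "of_real (\<beta> k) - 2 * a * of_real (\<alpha> k)"
  let ?c0 = "1 - a * of_real (\<beta> k) + a\<^sup>2 * of_real (\<alpha> k)"
  have z: "(\<lambda>r. (of_nat r + a) powr (2 - s)) sums (- bern_fun (3 - s) a / (3 - s))"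
          "(\<lambda>r. (of_nat r + a) powr (1 - s)) sums (- bern_fun (2 - s) a / (2 - s))"
          "(\<lambda>r. (of_nat r + a) powr (- s)) sums (- bern_fun (1 - s) a / (1 - s))"
    using s hurwitz_sums_bern_fun[of "3 - s" a] hurwitz_sums_bern_fun[of "2 - s" a]
      hurwitz_sums_bern_fun[of "1 - s" a] by simp_all
  have "of_real (aug_tri (r + 1) k) * (of_nat r + a) powr (- s) =
     ?c2 * (of_nat r + a) powr (2 - s) + ?c1 * (of_nat r + a) powr (1 - s)
     + ?c0 * (of_nat r + a) powr (- s)" for r
  proof -
    define x where "x = of_nat r + a"
    have "x \<noteq> 0"
      unfolding x_def by (rule of_nat_add_neq_0[OF a])
    hence pw: "x powr (2 - s) = x\<^sup>2 * x powr (- s)" "x powr (1 - s) = x * x powr (- s)"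
      by (simp_all add: powr_diff powr_minus field_simps)
    have r: "of_real (real r) = x - a" by (simp add: x_def)
    have A: "of_real (aug_tri (r + 1) k) = ?c2 * (x - a)\<^sup>2 + of_real (\<beta> k) * (x - a) + 1"
      unfolding aug_tri_def r[symmetric] by simp
    show ?thesis
      unfolding x_def[symmetric] pw A by (simp add: power2_eq_square algebra_simps)
  qed
  hence "(\<lambda>r. of_real (aug_tri (r + 1) k) * (of_nat r + a) powr (- s)) sums
     (?c2 * (- bern_fun (3 - s) a / (3 - s)) + ?c1 * (- bern_fun (2 - s) a / (2 - s))
     + ?c0 * (- bern_fun (1 - s) a / (1 - s)))"
    by (simp only:) (intro sums_add sums_mult z)
  thus ?thesis
    unfolding aug_series_def by (simp add: sums_iff)
qed

theorem theorem7p3: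
  fixes k m :: nat and a :: complex
  assumes "a \<notin> \<int>\<^sub>\<le>\<^sub>0"
  shows "aug_hurwitz k (- of_nat m) a =
    - of_real (\<alpha> k) * bernpoly (m + 3) a / of_nat (m + 3)
    - (of_real (\<beta> k) - 2 * a * of_real (\<alpha> k)) * bernpoly (m + 2) a / of_nat (m + 2)
    - (1 - a * of_real (\<beta> k) + a\<^sup>2 * of_real (\<alpha> k)) * bernpoly (m + 1) a / of_nat (m + 1)"
proof -
  \<comment> \<open>Each quotient has its only possible pole at 3, 2 or 1, away from the points \<open>- m\<close>.\<close>
  define H where "H s = - of_real (\<alpha> k) * bern_fun (3 - s) a / (3 - s)
    - (of_real (\<beta> k) - 2 * a * of_real (\<alpha> k)) * bern_fun (2 - s) a / (2 - s)
    - (1 - a * of_real (\<beta> k) + a\<^sup>2 * of_real (\<alpha> k)) * bern_fun (1 - s) a / (1 - s)" for s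
  have hol: "(\<lambda>s. bern_fun (c - s) a) holomorphic_on A" for c A
  proof -
    have "(\<lambda>s. c - s) holomorphic_on A" by (intro holomorphic_intros)
    from holomorphic_on_compose_gen[OF this holomorphic_bern_fun] show ?thesis
      by (simp add: o_def)
  qed
  have "H holomorphic_on - {1, 2, 3}"
    unfolding H_def by (intro holomorphic_intros hol) auto
  hence ana: "H analytic_on {s}" if "s \<notin> {1, 2, 3}" for s
    using that by (auto simp: analytic_at intro!: exI[of _ "- {1, 2, 3}"])
  have ent: "(\<lambda>s. bern_fun (c - s) a) meromorphic_on UNIV" for c
    by (intro analytic_on_imp_meromorphic_on) (simp add: analytic_on_open hol)
  have "H meromorphic_on UNIV"
    unfolding H_def by (intro meromorphic_intros ent)
  \<comment> \<open>At 1, 2 and 3 the formula for \<open>H\<close> gives an arbitrary value (division by 0), which has to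
    be normalised; everywhere else \<open>H\<close> is unchanged.\<close>
  hence nice: "remove_sings H nicely_meromorphic_on UNIV"
    by (rule remove_sings_nicely_meromorphic)
  have "meromorphic_continuation {s. Re s > 3} (\<lambda>s. aug_series k s a) = remove_sings H"
  proof (rule meromorphic_continuation_eqI[OF _ _ nice])
    show "open {s. Re s > 3}" by (rule open_halfspace_Re_gt)
    show "{s. Re s > 3} \<noteq> {}"
      by (metis (mono_tags) Re_complex_of_real empty_iff gt_ex mem_Collect_eq)
    fix s :: complex assume "s \<in> {s. Re s > 3}"
    hence s: "Re s > 3" by simp
    hence "s \<notin> {1, 2, 3}" by auto
    thus "remove_sings H s = aug_series k s a"
      using aug_series_conv_bern_fun[OF assms s, of k] by (simp add: ana H_def)
  qed
  moreover have "- of_nat m \<notin> {1, 2, 3 :: complex}"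
    by (auto simp: complex_eq_iff)
  ultimately have "aug_hurwitz k (- of_nat m) a = H (- of_nat m)"
    by (simp add: aug_hurwitz_def ana)
  moreover have "3 - (- of_nat m) = (of_nat (m + 3) :: complex)"
    "2 - (- of_nat m) = (of_nat (m + 2) :: complex)" "1 - (- of_nat m) = (of_nat (m + 1) :: complex)"
    by simp_all
  ultimately show ?thesis
    by (simp only: H_def bern_fun_of_nat[OF assms])
qed

end
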